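(* Every Zabavsky duo-domain is an elementary divisor ring.
   Context: All rings are associative with an identity, not necessarily commutative. A matrix $A$ (not necessarily square) over a ring $R$ admits diagonal reduction if there exist invertible matrices $P$ and $Q$ over $R$ such that $PAQ$ is a diagonal matrix $(d_{ij})$ with $Rd_{(i+1)(i+1)}R\subseteq d_{ii}R\cap Rd_{ii}$ for each $i$. A ring $R$ is an elementary divisor ring if every matrix over $R$ admits a diagonal reduction. A ring is a Bézout ring if every finitely generated right ideal and every finitely generated left ideal is principal. A ring is duo if every right ideal and every left ideal is a two-sided ideal. A domain is a ring with no nonzero zero divisors (not necessarily commutative). $J(R)$ denotes the Jacobson radical of $R$. In a duo ring, $s'$ is a divisor of $s$ if $s\in s'R$. An element $c\in R$ is feckly adequate if for every $a\in R$ there exist $r,s\in R$ such that (i) $c\equiv rs \pmod{J(R)}$; (ii) $rR+aR=R$; (iii) $s'R+aR\neq R$ for each non-invertible divisor $s'$ of $s$. A Bézout domain $R$ is a Zabavsky domain if whenever $aR+bR=R$ with $a,b\in R$ there exists $y\in R$ such that $a+by$ is feckly adequate. A Zabavsky duo-domain is a Zabavsky domain that is a duo ring. *)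

theory Defs
  imports "Jordan_Normal_Form.Matrix" "HOL-Library.Set_Algebras"
begin

text \<open>
  A ring is a type of class \<open>ring_1\<close> (not necessarily commutative), a domain a type of class
  \<open>ring_1_no_zero_divisors\<close>. These classes include \<open>0 \<noteq> 1\<close>. Properties of a whole ring are
  predicates on its type token.
\<close>

definition right_ideal :: "'a::ring_1 set \<Rightarrow> bool" where
  "right_ideal I \<longleftrightarrow>
     0 \<in> I \<and> (\<forall>x\<in>I. \<forall>y\<in>I. x - y \<in> I) \<and> (\<forall>x\<in>I. \<forall>r. x * r \<in> I)"

definition left_ideal :: "'a::ring_1 set \<Rightarrow> bool" where
  "left_ideal I \<longleftrightarrow>
     0 \<in> I \<and> (\<forall>x\<in>I. \<forall>y\<in>I. x - y \<in> I) \<and> (\<forall>x\<in>I. \<forall>r. r * x \<in> I)"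

definition two_sided_ideal :: "'a::ring_1 set \<Rightarrow> bool" where
  "two_sided_ideal I \<longleftrightarrow> right_ideal I \<and> left_ideal I"

text \<open>\<open>rmul a\<close>, \<open>lmul a\<close> and \<open>bimul a\<close> are the principal ideals $aR$, $Ra$ and $RaR$.
  The last one consists of finite sums of products $ras$, hence the hull.\<close>

definition rmul :: "'a::ring_1 \<Rightarrow> 'a set" where
  "rmul a = {a * r | r. True}"

definition lmul :: "'a::ring_1 \<Rightarrow> 'a set" where
  "lmul a = {r * a | r. True}"

definition bimul :: "'a::ring_1 \<Rightarrow> 'a set" where
  "bimul a = two_sided_ideal hull {a}"

definition duo_ring :: "'a::ring_1 itself \<Rightarrow> bool" where
  "duo_ring _ \<longleftrightarrow>
     (\<forall>I::'a set. right_ideal I \<longrightarrow> two_sided_ideal I) \<and>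
     (\<forall>I::'a set. left_ideal I \<longrightarrow> two_sided_ideal I)"

definition bezout_ring :: "'a::ring_1 itself \<Rightarrow> bool" where
  "bezout_ring _ \<longleftrightarrow>
     (\<forall>S::'a set. finite S \<longrightarrow> (\<exists>d. right_ideal hull S = rmul d)) \<and>
     (\<forall>S::'a set. finite S \<longrightarrow> (\<exists>d. left_ideal hull S = lmul d))"

definition maximal_right_ideal :: "'a::ring_1 set \<Rightarrow> bool" where
  "maximal_right_ideal M \<longleftrightarrow>
     right_ideal M \<and> M \<noteq> UNIV \<and>
     (\<forall>I. right_ideal I \<and> M \<subseteq> I \<and> I \<noteq> UNIV \<longrightarrow> I = M)"

definition jacobson_radical :: "'a::ring_1 set" where
  "jacobson_radical = \<Inter> {M. maximal_right_ideal M}"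

definition invertible_elt :: "'a::ring_1 \<Rightarrow> bool" where
  "invertible_elt u \<longleftrightarrow> (\<exists>v. u * v = 1 \<and> v * u = 1)"

text \<open>Sums of sets are elementwise (\<open>Set_Algebras\<close>), so \<open>rmul a + rmul b\<close> is $aR + bR$.
  The condition \<open>s \<in> rmul s'\<close> says that $s'$ is a divisor of $s$; the word is used in this
  sense for duo rings.\<close>

definition feckly_adequate :: "'a::ring_1 \<Rightarrow> bool" where
  "feckly_adequate c \<longleftrightarrow>
     (\<forall>a. \<exists>r s.
        c - r * s \<in> jacobson_radical \<and>
        rmul r + rmul a = UNIV \<and>
        (\<forall>s'. s \<in> rmul s' \<and> \<not> invertible_elt s' \<longrightarrow> rmul s' + rmul a \<noteq> UNIV))"

definition zabavsky_domain :: "'a::ring_1_no_zero_divisors itself \<Rightarrow> bool" where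
  "zabavsky_domain R \<longleftrightarrow>
     bezout_ring R \<and>
     (\<forall>a b::'a. rmul a + rmul b = UNIV \<longrightarrow> (\<exists>y. feckly_adequate (a + b * y)))"

text \<open>Matrix indices start at 0. The divisibility condition concerns consecutive diagonal
  positions that both lie inside the (possibly rectangular) matrix.\<close>

definition admits_diagonal_reduction :: "'a::ring_1 mat \<Rightarrow> bool" where
  "admits_diagonal_reduction A \<longleftrightarrow>
     (\<exists>P Q D. P \<in> carrier_mat (dim_row A) (dim_row A) \<and> invertible_mat P \<and>
        Q \<in> carrier_mat (dim_col A) (dim_col A) \<and> invertible_mat Q \<and>
        D = P * A * Q \<and> diagonal_mat D \<and>
        (\<forall>i. Suc i < min (dim_row A) (dim_col A) \<longrightarrow>
           bimul (D $$ (Suc i, Suc i)) \<subseteq> rmul (D $$ (i, i)) \<inter> lmul (D $$ (i, i))))"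

definition elementary_divisor_ring :: "'a::ring_1 itself \<Rightarrow> bool" where
  "elementary_divisor_ring _ \<longleftrightarrow> (\<forall>A::'a mat. admits_diagonal_reduction A)"

end

theory Submission
  imports Defs
begin

text \<open>
  In a duo ring divisibility is two-sided, and a Bezout domain is Hermite: every row or column of
  length two is reduced by an invertible $2 \times 2$ matrix. By induction on the rows it thus
  suffices to bring the greatest common divisor $\delta$ of the entries of
  $\begin{pmatrix} b & a \cr c & 0 \end{pmatrix}$ into the corner. Say $\delta = 1$ and
  $bx + ay + cz = 1$. The entry $b$ can be changed by any element of $aR + Rc$, in particular to the
  feckly adequate element $b + (ay + cz)t$. Reducing the first column gives
  $\begin{pmatrix} d & e \cr 0 & f \end{pmatrix}$, where $d$ divides that feckly adequate element.
  If $r$, $s$ is its factorization with respect to $e$, then $dR + (e + rf)R = R$: a common divisor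
  of $d$ and $e + rf$ is comaximal with $r$, so modulo the radical it divides $s$, and if it were not
  a unit it would share a non-unit factor with $e$, and this factor would divide $f$ as well.
\<close>

section \<open>Invertible operations on two rows or two columns\<close>

text \<open>The two-sided inverse, with rows \<open>(x', y')\<close> and \<open>(u', w')\<close>, is
  asked for entry by entry, since over a noncommutative ring no determinant decides
  invertibility.\<close>

definition invertible_2x2 :: "'a::ring_1 \<Rightarrow> 'a \<Rightarrow> 'a \<Rightarrow> 'a \<Rightarrow> bool" where
  "invertible_2x2 x y u w \<longleftrightarrow> (\<exists>x' y' u' w'.
     x * x' + y * u' = 1 \<and> x * y' + y * w' = 0 \<and> u * x' + w * u' = 0 \<and> u * y' + w * w' = 1 \<and>
     x' * x + y' * u = 1 \<and> x' * y + y' * w = 0 \<and> u' * x + w' * u = 0 \<and> u' * y + w' * w = 1)"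

text \<open>\<open>row_op\<close> and \<open>col_op\<close> multiply two rows from the left, respectively two columns from the
  right, by the matrix with rows \<open>(x, y)\<close> and \<open>(u, w)\<close>.\<close>

definition row_op :: "nat \<Rightarrow> nat \<Rightarrow> 'a::ring_1 \<Rightarrow> 'a \<Rightarrow> 'a \<Rightarrow> 'a \<Rightarrow>
    (nat \<Rightarrow> nat \<Rightarrow> 'a) \<Rightarrow> nat \<Rightarrow> nat \<Rightarrow> 'a" where
  "row_op k l x y u w A = (\<lambda>i j. if i = k then x * A k j + y * A l j
     else if i = l then u * A k j + w * A l j else A i j)"

definition col_op :: "nat \<Rightarrow> nat \<Rightarrow> 'a::ring_1 \<Rightarrow> 'a \<Rightarrow> 'a \<Rightarrow> 'a \<Rightarrow>
    (nat \<Rightarrow> nat \<Rightarrow> 'a) \<Rightarrow> nat \<Rightarrow> nat \<Rightarrow> 'a" where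
  "col_op k l x y u w A = (\<lambda>i j. if j = k then A i k * x + A i l * u
     else if j = l then A i k * y + A i l * w else A i j)"

text \<open>Arrays are indexed by all of \<open>nat\<close>, so no submatrices have to be formed:
  \<open>I\<close> and \<open>J\<close> bound the rows and columns that may be combined, but every
  operation acts along their full length.\<close>

inductive reach :: "nat set \<Rightarrow> nat set \<Rightarrow> (nat \<Rightarrow> nat \<Rightarrow> 'a::ring_1) \<Rightarrow> (nat \<Rightarrow> nat \<Rightarrow> 'a) \<Rightarrow> bool"
  for I J where
  refl: "reach I J A A"
| row: "\<lbrakk>reach I J A B; k \<in> I; l \<in> I; k \<noteq> l; invertible_2x2 x y u w\<rbrakk>
    \<Longrightarrow> reach I J A (row_op k l x y u w B)"
| col: "\<lbrakk>reach I J A B; k \<in> J; l \<in> J; k \<noteq> l; invertible_2x2 x y u w\<rbrakk>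
    \<Longrightarrow> reach I J A (col_op k l x y u w B)"

lemma reach_trans:
  assumes "reach I J A B" "reach I J B C"
  shows "reach I J A C"
  using assms(2,1) by (induction) (auto intro: reach.intros)

lemma reach_mono:
  assumes "reach I J A B" "I \<subseteq> I'" "J \<subseteq> J'"
  shows "reach I' J' A B"
  using assms by (induction) (auto intro: reach.intros)

lemma invertible_2x2_add_upper: "invertible_2x2 1 t 0 (1::'a::ring_1)"
  unfolding invertible_2x2_def
  by (rule exI[of _ 1], rule exI[of _ "-t"], rule exI[of _ 0], rule exI[of _ 1]) simp

lemma invertible_2x2_add_lower: "invertible_2x2 1 0 t (1::'a::ring_1)"
  unfolding invertible_2x2_def
  by (rule exI[of _ 1], rule exI[of _ 0], rule exI[of _ "-t"], rule exI[of _ 1]) simp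

lemma invertible_2x2_swap: "invertible_2x2 0 1 1 (0::'a::ring_1)"
  unfolding invertible_2x2_def
  by (rule exI[of _ 0], rule exI[of _ 1], rule exI[of _ 1], rule exI[of _ 0]) simp

lemma reach_row_op: "\<lbrakk>k \<in> I; l \<in> I; k \<noteq> l; invertible_2x2 x y u w\<rbrakk>
    \<Longrightarrow> reach I J A (row_op k l x y u w A)"
  by (intro reach.intros)

lemma reach_col_op: "\<lbrakk>k \<in> J; l \<in> J; k \<noteq> l; invertible_2x2 x y u w\<rbrakk>
    \<Longrightarrow> reach I J A (col_op k l x y u w A)"
  by (intro reach.intros)

text \<open>One row of the associativity of the \<open>2 x 2\<close> action. With \<open>e\<close>
  and \<open>f\<close> equal to 0 and 1 it makes an operation and its inverse cancel.\<close>

lemma comp_2x2_left: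
  fixes p q a b c d e f z w :: "'a::ring_1"
  assumes "p * a + q * c = e" "p * b + q * d = f"
  shows "p * (a * z + b * w) + q * (c * z + d * w) = e * z + f * w"
  unfolding assms[symmetric] by (simp add: algebra_simps)

lemma comp_2x2_right:
  fixes p q a b c d e f z w :: "'a::ring_1"
  assumes "a * p + c * q = e" "b * p + d * q = f"
  shows "(z * a + w * b) * p + (z * c + w * d) * q = z * e + w * f"
  unfolding assms[symmetric] by (simp add: algebra_simps)

text \<open>The identities are uniform in the array because they are needed for arrays met in
  \<open>reach\<close> as well as for the identity matrix.\<close>

lemma invertible_2x2_row_op:
  assumes "invertible_2x2 x y u w" "k \<noteq> l"
  obtains x' y' u' w' where "invertible_2x2 x' y' u' w'" "\<And>A. row_op k l x' y' u' w' (row_op k l x y u w A) = A"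
    "\<And>A. row_op k l x y u w (row_op k l x' y' u' w' A) = A"
proof -
  from assms(1) obtain x' y' u' w' where *: "x * x' + y * u' = 1" "x * y' + y * w' = 0"
    "u * x' + w * u' = 0" "u * y' + w * w' = 1"
    "x' * x + y' * u = 1" "x' * y + y' * w = 0" "u' * x + w' * u = 0" "u' * y + w' * w = 1"
    unfolding invertible_2x2_def by blast
  have "invertible_2x2 x' y' u' w'" unfolding invertible_2x2_def using * by blast
  moreover have "row_op k l x' y' u' w' (row_op k l x y u w A) = A" for A
    using assms(2) comp_2x2_left[OF *(5,6)] comp_2x2_left[OF *(7,8)] by (auto simp: row_op_def fun_eq_iff)
  moreover have "row_op k l x y u w (row_op k l x' y' u' w' A) = A" for A
    using assms(2) comp_2x2_left[OF *(1,2)] comp_2x2_left[OF *(3,4)] by (auto simp: row_op_def fun_eq_iff)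
  ultimately show ?thesis using that by blast
qed

lemma invertible_2x2_col_op:
  assumes "invertible_2x2 x y u w" "k \<noteq> l"
  obtains x' y' u' w' where "invertible_2x2 x' y' u' w'" "\<And>A. col_op k l x' y' u' w' (col_op k l x y u w A) = A"
    "\<And>A. col_op k l x y u w (col_op k l x' y' u' w' A) = A"
proof -
  from assms(1) obtain x' y' u' w' where *: "x * x' + y * u' = 1" "x * y' + y * w' = 0"
    "u * x' + w * u' = 0" "u * y' + w * w' = 1"
    "x' * x + y' * u = 1" "x' * y + y' * w = 0" "u' * x + w' * u = 0" "u' * y + w' * w = 1"
    unfolding invertible_2x2_def by blast
  have "invertible_2x2 x' y' u' w'" unfolding invertible_2x2_def using * by blast
  moreover have "col_op k l x' y' u' w' (col_op k l x y u w A) = A" for A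
    using assms(2) comp_2x2_right[OF *(1,3)] comp_2x2_right[OF *(2,4)] by (auto simp: col_op_def fun_eq_iff)
  moreover have "col_op k l x y u w (col_op k l x' y' u' w' A) = A" for A
    using assms(2) comp_2x2_right[OF *(5,7)] comp_2x2_right[OF *(6,8)] by (auto simp: col_op_def fun_eq_iff)
  ultimately show ?thesis using that by blast
qed

text \<open>Reversibility lets common divisors travel backwards: what divides all entries after the
  operations divides them before.\<close>

lemma reach_sym:
  assumes "reach I J A B" shows "reach I J B A"
  using assms
proof (induction)
  case (refl A) show ?case by (rule reach.refl)
next
  case (row A B k l x y u w)
  obtain x' y' u' w' where "invertible_2x2 x' y' u' w'" and inv: "row_op k l x' y' u' w' (row_op k l x y u w B) = B"
    using invertible_2x2_row_op[OF row(5,4)] by metis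
  then have "reach I J (row_op k l x y u w B) B"
    using reach_row_op[OF row(2-4), of x' y' u' w' J "row_op k l x y u w B"] by simp
  then show ?case using row.IH by (rule reach_trans)
next
  case (col A B k l x y u w)
  obtain x' y' u' w' where "invertible_2x2 x' y' u' w'" and inv: "col_op k l x' y' u' w' (col_op k l x y u w B) = B"
    using invertible_2x2_col_op[OF col(5,4)] by metis
  then have "reach I J (col_op k l x y u w B) B"
    using reach_col_op[OF col(2-4), of x' y' u' w' I "col_op k l x y u w B"] by simp
  then show ?case using col.IH by (rule reach_trans)
qed

lemma reach_outside:
  assumes "reach I J A B" "i \<notin> I" "j \<notin> J"
  shows "B i j = A i j"
  using assms by (induction) (auto simp: row_op_def col_op_def)

text \<open>Row operations do not touch a row outside \<open>I\<close>, and column operations only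
  combine its zeros in \<open>J\<close>.\<close>

lemma reach_zero_row:
  assumes "reach I J A B" "i \<notin> I" "\<And>j. j \<in> J \<Longrightarrow> A i j = 0" "j \<in> J"
  shows "B i j = 0"
  using assms by (induction arbitrary: j) (auto simp: row_op_def col_op_def)

lemma reach_zero_col:
  assumes "reach I J A B" "j \<notin> J" "\<And>i. i \<in> I \<Longrightarrow> A i j = 0" "i \<in> I"
  shows "B i j = 0"
  using assms by (induction arbitrary: i) (auto simp: row_op_def col_op_def)

text \<open>The library relation \<open>dvd\<close> is not available in noncommutative rings: \<open>ring_1\<close> is not a
  subclass of its class.\<close>

definition ldvd :: "'a::ring_1 \<Rightarrow> 'a \<Rightarrow> bool" (infix "ldvd" 50) where
  "a ldvd b \<longleftrightarrow> (\<exists>k. b = a * k)"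

lemma ldvdI: "b = a * k \<Longrightarrow> a ldvd b"
  unfolding ldvd_def ..

section \<open>Comaximality, maximal right ideals and the radical\<close>

lemma rmul_sum_UNIV_iff:
  "rmul a + rmul b = UNIV \<longleftrightarrow> (\<exists>x y. a * x + b * y = (1::'a::ring_1))"
proof
  assume "rmul a + rmul b = UNIV"
  then have "1 \<in> rmul a + rmul b" by simp
  then show "\<exists>x y. a * x + b * y = 1" unfolding rmul_def set_plus_def by auto
next
  assume "\<exists>x y. a * x + b * y = 1"
  then obtain x y where *: "a * x + b * y = 1" by blast
  have "z \<in> rmul a + rmul b" for z
  proof -
    have "z = a * (x * z) + b * (y * z)"
      unfolding mult.assoc[symmetric] distrib_right[symmetric] * by simp
    then show ?thesis unfolding rmul_def set_plus_def by blast
  qed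
  then show "rmul a + rmul b = UNIV" by blast
qed

lemma right_ideal_rmul: "right_ideal (rmul a)"
  unfolding right_ideal_def rmul_def
  by (auto simp: mult.assoc right_diff_distrib[symmetric] intro: exI[of _ 0])

lemma left_ideal_lmul: "left_ideal (lmul a)"
  unfolding left_ideal_def lmul_def
  by (auto simp: mult.assoc[symmetric] left_diff_distrib[symmetric] intro: exI[of _ 0])

lemma right_ideal_add: "right_ideal I \<Longrightarrow> x \<in> I \<Longrightarrow> y \<in> I \<Longrightarrow> x + y \<in> I"
  unfolding right_ideal_def by (metis diff_0 diff_minus_eq_add)

text \<open>Zorn's lemma, applied to the right ideals that avoid 1: this form of properness visibly
  passes to unions of chains.\<close>

lemma proper_in_maximal_right_ideal:
  assumes "right_ideal I" "(1::'a::ring_1) \<notin> I"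
  obtains M where "maximal_right_ideal M" "I \<subseteq> M"
proof -
  let ?A = "{K::'a set. right_ideal K \<and> I \<subseteq> K \<and> 1 \<notin> K}"
  have "\<exists>M\<in>?A. \<forall>X\<in>?A. M \<subseteq> X \<longrightarrow> X = M"
  proof (rule subset_Zorn_nonempty)
    show "?A \<noteq> {}" using assms by auto
    fix C assume C: "C \<noteq> {}" "subset.chain ?A C"
    have sub: "C \<subseteq> ?A" and tot: "\<And>X Y. X \<in> C \<Longrightarrow> Y \<in> C \<Longrightarrow> X \<subseteq> Y \<or> Y \<subseteq> X"
      using C(2) unfolding subset_chain_def by blast+
    have "right_ideal (\<Union>C)"
      unfolding right_ideal_def
    proof (intro conjI ballI allI)
      show "0 \<in> \<Union>C" using C(1) sub unfolding right_ideal_def by auto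
    next
      fix x y assume "x \<in> \<Union>C" "y \<in> \<Union>C"
      then obtain X where "X \<in> C" "x \<in> X" "y \<in> X" using tot by blast
      then show "x - y \<in> \<Union>C" using sub unfolding right_ideal_def by blast
    next
      fix x r assume "x \<in> \<Union>C"
      then show "x * r \<in> \<Union>C" using sub unfolding right_ideal_def by blast
    qed
    then show "\<Union>C \<in> ?A" using C(1) sub by blast
  qed
  then obtain M where M: "right_ideal M" "I \<subseteq> M" "1 \<notin> M"
    "\<And>X. right_ideal X \<Longrightarrow> I \<subseteq> X \<Longrightarrow> 1 \<notin> X \<Longrightarrow> M \<subseteq> X \<Longrightarrow> X = M" by auto
  have "1 \<notin> K" if "right_ideal K" "K \<noteq> UNIV" for K :: "'a set"
    using that unfolding right_ideal_def by (metis UNIV_eq_I mult_1)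
  then have "maximal_right_ideal M" unfolding maximal_right_ideal_def using M by blast
  with M(2) show ?thesis using that by blast
qed

text \<open>Otherwise \<open>1 - j * y\<close> lies in a maximal right ideal, which contains
  \<open>j\<close> too and hence 1.\<close>

lemma jacobson_radical_right_inverse:
  assumes "j \<in> jacobson_radical"
  shows "\<exists>z. (1 - j * y) * z = (1::'a::ring_1)"
proof (rule ccontr)
  assume "\<not> ?thesis"
  then have "1 \<notin> rmul (1 - j * y)" unfolding rmul_def by auto
  then obtain M where M: "maximal_right_ideal M" "rmul (1 - j * y) \<subseteq> M"
    using proper_in_maximal_right_ideal right_ideal_rmul by metis
  then have ri: "right_ideal M" and "M \<noteq> UNIV" unfolding maximal_right_ideal_def by auto
  have "j \<in> M" using assms M(1) unfolding jacobson_radical_def by blast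
  then have "j * y \<in> M" using ri unfolding right_ideal_def by blast
  moreover have "1 - j * y \<in> M" using M(2) unfolding rmul_def by (auto intro: exI[of _ 1])
  ultimately have "1 - j * y + j * y \<in> M" using right_ideal_add[OF ri] by blast
  then have "1 \<in> M" by simp
  then have "M = UNIV" using ri unfolding right_ideal_def by (metis UNIV_eq_I mult_1)
  with \<open>M \<noteq> UNIV\<close> show False ..
qed

subsection \<open>Duo Bezout domains\<close>

locale duo_bezout_domain =
  fixes T :: "'a::ring_1_no_zero_divisors itself"
  assumes duo: "duo_ring T" and bezout: "bezout_ring T"
begin

text \<open>Every element is normal because \<open>rmul a\<close> is two-sided. This replaces
  commutativity throughout, at the price of changing the factor that is moved.\<close>

lemma commute_right: "\<exists>r'. r * a = a * (r'::'a)"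
proof -
  have "two_sided_ideal (rmul a)" using duo right_ideal_rmul unfolding duo_ring_def by blast
  moreover have "a \<in> rmul a" unfolding rmul_def by (auto intro: exI[of _ 1])
  ultimately have "r * a \<in> rmul a" unfolding two_sided_ideal_def left_ideal_def by blast
  then show ?thesis unfolding rmul_def by blast
qed

lemma commute_left: "\<exists>r'. a * r = r' * (a::'a)"
proof -
  have "two_sided_ideal (lmul a)" using duo left_ideal_lmul unfolding duo_ring_def by blast
  moreover have "a \<in> lmul a" unfolding lmul_def by (auto intro: exI[of _ 1])
  ultimately have "a * r \<in> lmul a" unfolding two_sided_ideal_def right_ideal_def by blast
  then show ?thesis unfolding lmul_def by blast
qed

lemma ldvd_refl: "(a::'a) ldvd a" by (rule ldvdI[of _ _ 1]) simp
lemma ldvd_0: "(a::'a) ldvd 0" by (rule ldvdI[of _ _ 0]) simp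
lemma ldvd_trans: "(a::'a) ldvd b \<Longrightarrow> b ldvd c \<Longrightarrow> a ldvd c"
  unfolding ldvd_def by (auto simp: mult.assoc)
lemma ldvd_mult2: "(a::'a) ldvd b \<Longrightarrow> a ldvd b * c"
  unfolding ldvd_def by (auto simp: mult.assoc)
lemma ldvd_add: "(a::'a) ldvd b \<Longrightarrow> a ldvd c \<Longrightarrow> a ldvd b + c"
  unfolding ldvd_def by (auto simp: distrib_left[symmetric])
lemma ldvd_minus: "(a::'a) ldvd b \<Longrightarrow> a ldvd - b"
  unfolding ldvd_def by (metis mult_minus_right)
lemma ldvd_mult: "(a::'a) ldvd b \<Longrightarrow> a ldvd c * b"
  by (metis commute_right ldvd_mult2)
lemma ldvd_left: "(a::'a) ldvd b \<Longrightarrow> \<exists>k. b = k * a"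
  unfolding ldvd_def using commute_left by blast
lemmas ldvd = ldvd_0 ldvd_add ldvd_mult2

text \<open>The combinations \<open>a * x + b * y\<close> already form a right ideal containing
  \<open>a\<close> and \<open>b\<close>, so the generator of the hull is one of them.\<close>

lemma gcd_right: "\<exists>d x y. (a::'a) * x + b * y = d \<and> d ldvd a \<and> d ldvd b"
proof -
  obtain d where d: "right_ideal hull {a, b} = rmul d"
    using bezout unfolding bezout_ring_def by (meson finite.emptyI finite.insertI)
  have "a \<in> rmul d" "b \<in> rmul d" using hull_subset[of "{a,b}" right_ideal] unfolding d by auto
  then have dv: "d ldvd a" "d ldvd b" unfolding rmul_def ldvd_def by auto
  let ?I = "{a * x + b * y | x y. True}"
  have "right_ideal ?I" unfolding right_ideal_def
  proof (intro conjI ballI allI)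
    show "0 \<in> ?I" by (auto intro!: exI[of _ 0])
  next
    fix u v assume "u \<in> ?I" "v \<in> ?I"
    then obtain x y z w where "u = a * x + b * y" "v = a * z + b * w" by blast
    then have "u - v = a * (x - z) + b * (y - w)" by (simp add: algebra_simps)
    then show "u - v \<in> ?I" by blast
  next
    fix u r assume "u \<in> ?I"
    then obtain x y where "u = a * x + b * y" by blast
    then have "u * r = a * (x * r) + b * (y * r)" by (simp add: algebra_simps)
    then show "u * r \<in> ?I" by blast
  qed
  moreover have "a = a * 1 + b * 0" "b = a * 0 + b * 1" by simp_all
  then have "{a, b} \<subseteq> ?I" by blast
  ultimately have "right_ideal hull {a, b} \<subseteq> ?I" by (intro hull_minimal)
  moreover have "d \<in> rmul d" unfolding rmul_def by (auto intro: exI[of _ 1])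
  ultimately have "d \<in> ?I" unfolding d by blast
  then show ?thesis using dv by blast
qed

text \<open>Normality carries the coefficients and cofactors of \<open>gcd_right\<close> to the
  other side.\<close>

lemma gcd_left: "\<exists>d x y a' b'. x * (a::'a) + y * b = d \<and> a = a' * d \<and> b = b' * d"
  by (metis gcd_right commute_left ldvd_left)

section \<open>Hermite reduction of rows and columns of length two\<close>

text \<open>Cancelling \<open>d\<close> leaves a unimodular row \<open>(a', b')\<close>. The columns
  of the matrix are a solution of \<open>a' * x + b' * y = 1\<close> and a generator of the kernel;
  its inverse has rows \<open>(a', b')\<close> and \<open>(s, -t)\<close>.\<close>

lemma hermite_right:
  "\<exists>x y u w d. invertible_2x2 x y u w \<and> (a::'a) * x + b * u = d \<and> a * y + b * w = 0 \<and> d ldvd a \<and> d ldvd b"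
proof (cases "b = 0")
  \<comment> \<open>Here the identity matrix works, as the transvection with parameter 0. Otherwise
    \<open>d\<close> and \<open>b'\<close> are nonzero and can be cancelled.\<close>
  case True
  then show ?thesis using invertible_2x2_add_upper[of 0] ldvd_refl ldvd_0
    by (intro exI[of _ 1] exI[of _ 0] exI[of _ a]) auto
next
  case False
  obtain d x y where d: "a * x + b * y = d" "d ldvd a" "d ldvd b" using gcd_right by blast
  obtain a' b' where ab: "a = d * a'" "b = d * b'" using d unfolding ldvd_def by blast
  have d0: "d \<noteq> 0" and b0: "b' \<noteq> 0" using False ab by auto
  have "d * (a' * x + b' * y) = d * 1" using d(1) unfolding ab by (simp add: algebra_simps)
  then have one: "a' * x + b' * y = 1" using d0 by (simp only: mult_cancel_left) simp
  then have by1: "b' * y = 1 - a' * x" by (simp add: eq_diff_eq add.commute)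
  obtain u p q s t where u: "(1 - x * a') * p + x * b' * q = u" and s: "1 - x * a' = u * s"
      and t: "x * b' = u * t" using gcd_right[of "1 - x * a'" "x * b'"] unfolding ldvd_def by blast
  text \<open>\<open>(u, w)\<close> freely generates the kernel of the unimodular row \<open>(a', b')\<close>: the columns
    \<open>(1 - xa', -ya')\<close> and \<open>(-xb', 1 - yb')\<close> span it, and \<open>u\<close> generates the right ideal of
    first coordinates.\<close>
  define w where "w = - y * a' * p - (1 - y * b') * q"
  have ker: "a' * u + b' * w = 0"
  proof -
    have "a' * u + b' * w = a' * p - a' * x * a' * p + a' * x * b' * q
       - (b' * y) * a' * p - b' * q + (b' * y) * b' * q"
      unfolding u[symmetric] w_def by (simp add: algebra_simps)
    also have "\<dots> = 0" unfolding by1 by (simp add: algebra_simps)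
    finally show ?thesis .
  qed
  \<comment> \<open>The four remaining identities of the inverse become visible only after
    multiplication by \<open>b'\<close> or by \<open>u\<close>, which is then cancelled in the
    domain.\<close>
  have "b' * (y * a' + w * s) = 0"
  proof -
    have "b' * (y * a' + w * s) = (b' * y) * a' + (b' * w) * s" by (simp add: algebra_simps)
    also have "b' * w = - (a' * u)" using ker by (simp add: eq_neg_iff_add_eq_0 add.commute)
    also have "(b' * y) * a' + - (a' * u) * s = (b' * y) * a' - a' * (1 - x * a')"
      unfolding s by (simp add: algebra_simps)
    also have "\<dots> = 0" unfolding by1 by (simp add: algebra_simps)
    finally show ?thesis .
  qed
  then have e1: "y * a' + w * s = 0" using b0 by simp
  have "b' * (y * b' - w * t - 1) = 0"
  proof -
    have "b' * (y * b' - w * t - 1) = (b' * y) * b' - (b' * w) * t - b'" by (simp add: algebra_simps)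
    also have "b' * w = - (a' * u)" using ker by (simp add: eq_neg_iff_add_eq_0 add.commute)
    also have "(b' * y) * b' - - (a' * u) * t - b' = (b' * y) * b' + a' * (x * b') - b'"
      unfolding t by (simp add: algebra_simps)
    also have "\<dots> = 0" unfolding by1 by (simp add: algebra_simps)
    finally show ?thesis .
  qed
  then have e2: "y * b' - w * t = 1" using b0 by simp
  have u0: "u \<noteq> 0"
  proof
    assume "u = 0"
    then have "x * a' = 1" "x * b' = 0" using s t by auto
    then show False using b0 by auto
  qed
  have "u * (s * x - t * y) = 0"
  proof -
    have "u * (s * x - t * y) = (u * s) * x - (u * t) * y" by (simp add: algebra_simps)
    also have "\<dots> = x - x * (a' * x + b' * y)" unfolding s[symmetric] t[symmetric] by (simp add: algebra_simps)
    finally show ?thesis unfolding one by simp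
  qed
  then have e3: "s * x - t * y = 0" using u0 by simp
  have "u * (s * u - t * w - 1) = 0"
  proof -
    have "u * (s * u - t * w - 1) = (u * s) * u - (u * t) * w - u" by (simp add: algebra_simps)
    also have "\<dots> = - x * (a' * u + b' * w)" unfolding s[symmetric] t[symmetric] by (simp add: algebra_simps)
    finally show ?thesis unfolding ker by simp
  qed
  then have e4: "s * u - t * w = 1" using u0 by simp
  have "invertible_2x2 x u y w" unfolding invertible_2x2_def
    by (rule exI[of _ a'], rule exI[of _ b'], rule exI[of _ s], rule exI[of _ "-t"])
      (use one ker e1 e2 e3 e4 s t in \<open>simp add: s[symmetric]\<close>)
  moreover have "a * u + b * w = 0" using ker unfolding ab mult.assoc distrib_left[symmetric] by simp
  ultimately show ?thesis using d by blast
qed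

text \<open>The mirror image of \<open>hermite_right\<close>: \<open>d\<close> arises as a right
  factor of \<open>a\<close> and \<open>b\<close>, and normality makes it a left one at the
  end.\<close>

lemma hermite_left:
  "\<exists>x y u w d. invertible_2x2 x y u w \<and> x * (a::'a) + y * b = d \<and> u * a + w * b = 0 \<and> d ldvd a \<and> d ldvd b"
proof (cases "b = 0")
  case True
  then show ?thesis using invertible_2x2_add_upper[of 0] ldvd_refl ldvd_0
    by (intro exI[of _ 1] exI[of _ 0] exI[of _ a]) auto
next
  case False
  obtain d x y a' b' where d: "x * a + y * b = d" and ab: "a = a' * d" "b = b' * d"
    using gcd_left by blast
  have d0: "d \<noteq> 0" and b0: "b' \<noteq> 0" using False ab by auto
  have "(x * a' + y * b') * d = 1 * d" using d(1) unfolding ab by (simp add: algebra_simps)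
  then have one: "x * a' + y * b' = 1" using d0 by (simp only: mult_cancel_right) simp
  then have by1: "y * b' = 1 - x * a'" by (simp add: eq_diff_eq add.commute)
  obtain u p q s t where u: "p * (1 - a' * x) + q * (b' * x) = u" and s: "1 - a' * x = s * u"
      and t: "b' * x = t * u" using gcd_left[of "1 - a' * x" "b' * x"] by metis
  \<comment> \<open>\<open>(u, w)\<close> is \<open>p\<close> times
    \<open>(1 - a' * x, - a' * y)\<close> plus \<open>q\<close> times
    \<open>(b' * x, b' * y - 1)\<close>; both rows annihilate the column
    \<open>(a', b')\<close>.\<close>
  define w where "w = - p * a' * y - q * (1 - b' * y)"
  have ker: "u * a' + w * b' = 0"
  proof -
    have "u * a' + w * b' = p * a' - p * a' * (x * a') + q * b' * (x * a')
       - p * a' * (y * b') - q * b' + q * b' * (y * b')"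
      unfolding u[symmetric] w_def by (simp add: algebra_simps)
    also have "\<dots> = 0" unfolding by1 by (simp add: algebra_simps)
    finally show ?thesis .
  qed
  have wb: "w * b' = - (u * a')" using ker by (simp add: eq_neg_iff_add_eq_0 add.commute)
  have "(a' * y + s * w) * b' = 0"
  proof -
    have "(a' * y + s * w) * b' = a' * (y * b') + s * (w * b')" by (simp add: algebra_simps)
    also have "\<dots> = a' * (y * b') - (s * u) * a'" unfolding wb by (simp add: algebra_simps)
    also have "\<dots> = 0" unfolding by1 s[symmetric] by (simp add: algebra_simps)
    finally show ?thesis .
  qed
  then have e1: "a' * y + s * w = 0" using b0 by simp
  have "(b' * y - t * w - 1) * b' = 0"
  proof -
    have "(b' * y - t * w - 1) * b' = b' * (y * b') - t * (w * b') - b'" by (simp add: algebra_simps)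
    also have "\<dots> = b' * (y * b') + (t * u) * a' - b'" unfolding wb by (simp add: algebra_simps)
    also have "\<dots> = 0" unfolding by1 t[symmetric] by (simp add: algebra_simps)
    finally show ?thesis .
  qed
  then have e2: "b' * y - t * w = 1" using b0 by simp
  have u0: "u \<noteq> 0"
  proof
    assume "u = 0"
    then have "a' * x = 1" "b' * x = 0" using s t by auto
    then show False using b0 by auto
  qed
  have "(x * s - y * t) * u = 0"
  proof -
    have "(x * s - y * t) * u = x * (s * u) - y * (t * u)" by (simp add: algebra_simps)
    also have "\<dots> = x - (x * a' + y * b') * x" unfolding s[symmetric] t[symmetric] by (simp add: algebra_simps)
    finally show ?thesis unfolding one by simp
  qed
  then have e3: "x * s - y * t = 0" using u0 by simp
  have "(u * s - w * t - 1) * u = 0"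
  proof -
    have "(u * s - w * t - 1) * u = u * (s * u) - w * (t * u) - u" by (simp add: algebra_simps)
    also have "\<dots> = - ((u * a' + w * b') * x)" unfolding s[symmetric] t[symmetric] by (simp add: algebra_simps)
    finally show ?thesis unfolding ker by simp
  qed
  then have e4: "u * s - w * t = 1" using u0 by simp
  have "invertible_2x2 x y u w" unfolding invertible_2x2_def
    by (rule exI[of _ a'], rule exI[of _ s], rule exI[of _ b'], rule exI[of _ "-t"])
      (use one ker e1 e2 e3 e4 s t in \<open>simp add: s[symmetric]\<close>)
  moreover have "u * a + w * b = 0" using ker unfolding ab mult.assoc[symmetric] distrib_right[symmetric] by simp
  moreover have "d ldvd a" "d ldvd b" unfolding ab by (auto intro: ldvd_mult ldvd_refl)
  ultimately show ?thesis using d by blast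
qed

section \<open>Comaximality from feckly adequate elements\<close>

text \<open>Three greatest common divisors are chained: \<open>h\<close> of \<open>d\<close> and
  \<open>e + r * f\<close>, \<open>k\<close> of \<open>h\<close> and \<open>s\<close>,
  \<open>g\<close> of \<open>k\<close> and \<open>e\<close>. The last divides \<open>d\<close>,
  \<open>e\<close> and \<open>f\<close>, hence 1, so \<open>k\<close> is a divisor of
  \<open>s\<close> comaximal with \<open>e\<close> and thus invertible. So \<open>h\<close> is
  comaximal with \<open>s\<close>; as it divides \<open>s\<close> modulo the radical, it has a right
  inverse.\<close>

lemma feckly_adequate_stable:
  assumes fa: "feckly_adequate (b::'a)" and db: "d ldvd b" and uni: "d * x + e * y + f * z = 1"
  shows "\<exists>r x y. d * x + (e + r * f) * y = 1"
proof -
  obtain r s where js: "b - r * s \<in> jacobson_radical" and re: "rmul r + rmul e = UNIV"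
    and s: "\<And>s'. s \<in> rmul s' \<Longrightarrow> \<not> invertible_elt s' \<Longrightarrow> rmul s' + rmul e \<noteq> UNIV"
    using fa unfolding feckly_adequate_def by metis
  obtain r1 e1 where re1: "r * r1 + e * e1 = 1" using re unfolding rmul_sum_UNIV_iff by blast
  obtain h x1 y1 where h: "d * x1 + (e + r * f) * y1 = h" "h ldvd d" "h ldvd e + r * f"
    using gcd_right by blast
  obtain k x2 y2 where k: "h * x2 + s * y2 = k" "k ldvd h" "k ldvd s" using gcd_right by blast
  obtain g x3 y3 where g: "k * x3 + e * y3 = g" "g ldvd k" "g ldvd e" using gcd_right by blast
  have gf: "g ldvd r * f"
  proof -
    have "g ldvd e + r * f" using g k h ldvd_trans by blast
    from ldvd_add[OF this ldvd_minus[OF g(3)]] show ?thesis by (simp add: algebra_simps)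
  qed
  \<comment> \<open>\<open>r\<close> and \<open>e\<close> are comaximal, so \<open>f\<close> is a
    combination of \<open>r * f\<close> and \<open>e\<close>, once \<open>f\<close> has been moved
    past \<open>r1\<close>.\<close>
  have "g ldvd f"
  proof -
    have "f = r * r1 * f + e * e1 * f" unfolding distrib_right[symmetric] re1 by simp
    moreover obtain r' where "r1 * f = f * r'" using commute_right by blast
    ultimately have "f = r * f * r' + e * (e1 * f)" by (simp add: mult.assoc)
    moreover have "g ldvd r * f * r' + e * (e1 * f)" using gf g(3) by (intro ldvd_add ldvd_mult2[of g "r * f"] ldvd_mult2[of g e])
    ultimately show ?thesis by simp
  qed
  moreover have "g ldvd d" using g k h ldvd_trans by blast
  ultimately have "g ldvd d * x + e * y + f * z" using g(3) by (intro ldvd)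
  then obtain g' where "g * g' = 1" unfolding uni ldvd_def by metis
  then have "k * (x3 * g') + e * (y3 * g') = 1"
    unfolding mult.assoc[symmetric] distrib_right[symmetric] g(1) .
  then have "rmul k + rmul e = UNIV" unfolding rmul_sum_UNIV_iff by blast
  moreover have "s \<in> rmul k" using k(3) unfolding ldvd_def rmul_def by blast
  ultimately have "invertible_elt k" using s by blast
  then obtain k' where k': "k * k' = 1" unfolding invertible_elt_def by blast
  define \<alpha> \<beta> where "\<alpha> = x2 * k'" and "\<beta> = y2 * k'"
  have ab: "h * \<alpha> + s * \<beta> = 1"
    unfolding \<alpha>_def \<beta>_def mult.assoc[symmetric] distrib_right[symmetric] k(1) k' ..
  text \<open>Since \<open>h\<close> divides \<open>b\<close> and is comaximal with \<open>r\<close>, it divides \<open>s\<close> modulo the radical.\<close>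
  obtain \<eta> where \<eta>: "e + r * f = h * \<eta>" using h(3) unfolding ldvd_def by blast
  obtain b' where b': "b = h * b'" using ldvd_trans[OF h(2) db] unfolding ldvd_def by blast
  \<comment> \<open>Substituting \<open>e = h * \<eta> - r * f\<close> in \<open>re1\<close> and
    collecting the multiples of \<open>r\<close> gives this coefficient, so \<open>h\<close> and
    \<open>r\<close> are comaximal.\<close>
  define \<rho> where "\<rho> = r1 - f * e1"
  have one: "r * \<rho> + h * \<eta> * e1 = 1"
    unfolding \<eta>[symmetric] \<rho>_def re1[symmetric] by (simp add: algebra_simps)
  obtain \<rho>' where \<rho>': "\<rho> * s = s * \<rho>'" using commute_right by blast
  define j where "j = b - r * s"
  have jJ: "j \<in> jacobson_radical" using js j_def by simp
  have rs: "r * s = h * b' - j" unfolding j_def b' by simp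
  have "s = (r * \<rho> + h * \<eta> * e1) * s" unfolding one by simp
  also have "\<dots> = (r * s) * \<rho>' + h * \<eta> * e1 * s" by (simp add: distrib_right mult.assoc \<rho>')
  also have "\<dots> = h * (b' * \<rho>' + \<eta> * e1 * s) - j * \<rho>'" unfolding rs by (simp add: algebra_simps)
  finally have s_eq: "s = h * (b' * \<rho>' + \<eta> * e1 * s) - j * \<rho>'" .
  define \<tau> where "\<tau> = b' * \<rho>' + \<eta> * e1 * s"
  \<comment> \<open>Writing \<open>s\<close> as \<open>h * \<tau> - j * \<rho>'\<close> in
    \<open>ab\<close> produces a multiple of \<open>h\<close> that differs from 1 by a right
    multiple of \<open>j\<close>.\<close>
  have "h * (\<alpha> + \<tau> * \<beta>) = h * \<alpha> + (h * \<tau> - j * \<rho>') * \<beta> + j * \<rho>' * \<beta>" by (simp add: algebra_simps)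
  also have "\<dots> = 1 - j * (- (\<rho>' * \<beta>))"
    unfolding \<tau>_def s_eq[symmetric] ab by (simp add: mult.assoc)
  finally have "h * (\<alpha> + \<tau> * \<beta>) = 1 - j * (- (\<rho>' * \<beta>))" .
  then obtain v where v: "h * v = 1"
    using jacobson_radical_right_inverse[OF jJ, of "- (\<rho>' * \<beta>)"] by (metis mult.assoc)
  have "d * (x1 * v) + (e + r * f) * (y1 * v) = 1"
    unfolding mult.assoc[symmetric] distrib_right[symmetric] h(1) v ..
  then show ?thesis by blast
qed

section \<open>Divisibility under operations, and clearing of rows and columns\<close>

text \<open>Row operations put coefficients on the left; a left divisor survives this by
  normality.\<close>

lemma reach_ldvd:
  assumes "reach I J A B" "\<And>i j. i \<in> I \<Longrightarrow> j \<in> J \<Longrightarrow> (d::'a) ldvd A i j" "i \<in> I" "j \<in> J"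
  shows "d ldvd B i j"
  using assms
  by (induction arbitrary: i j)
    (auto simp: row_op_def col_op_def intro!: ldvd_add intro: ldvd_mult ldvd_mult2)

text \<open>Hermite steps merge the entries of row \<open>k\<close> into column \<open>l\<close> one
  at a time. Each touches only the columns \<open>l\<close> and \<open>j\<close>, so zeros made
  earlier in row \<open>k\<close> stay.\<close>

lemma row_reduce:
  assumes "finite S" "l \<notin> S"
  shows "\<exists>B. reach {} (insert l S) (A :: nat \<Rightarrow> nat \<Rightarrow> 'a) B \<and> (\<forall>j\<in>S. B k j = 0)"
  using assms
proof (induction S)
  case empty
  show ?case using reach.refl by blast
next
  case (insert j S)
  then obtain B where B: "reach {} (insert l S) A B" "\<forall>j\<in>S. B k j = 0" by auto
  obtain x y u w where *: "invertible_2x2 x y u w" "B k l * y + B k j * w = 0" using hermite_right by blast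
  have "reach {} (insert l (insert j S)) A (col_op l j x y u w B)"
    using insert by (intro reach.col[OF reach_mono[OF B(1)] _ _ _ *(1)]) auto
  moreover have "\<forall>m\<in>insert j S. col_op l j x y u w B k m = 0"
    using insert B(2) *(2) by (auto simp: col_op_def)
  ultimately show ?case by blast
qed

text \<open>When the pivot divides its row, transvections suffice. Unlike in
  \<open>row_reduce\<close>, column \<open>l\<close> is preserved, which \<open>clear_cross\<close>
  relies on.\<close>

lemma clear_row:
  assumes "finite S" "l \<notin> S" "\<And>j. j \<in> S \<Longrightarrow> (A :: nat \<Rightarrow> nat \<Rightarrow> 'a) k l ldvd A k j"
  shows "\<exists>B. reach {} (insert l S) A B \<and> (\<forall>i j. j \<notin> S \<longrightarrow> B i j = A i j) \<and> (\<forall>j\<in>S. B k j = 0)"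
  using assms
proof (induction S)
  case empty
  show ?case using reach.refl by blast
next
  case (insert j S)
  then obtain B where B: "reach {} (insert l S) A B" "\<And>i j. j \<notin> S \<Longrightarrow> B i j = A i j"
    "\<forall>j\<in>S. B k j = 0" by auto
  obtain v where v: "A k j = A k l * v" using insert.prems(2) unfolding ldvd_def by blast
  let ?C = "col_op l j 1 (- v) 0 1 B"
  have "reach {} (insert l (insert j S)) A ?C"
    using insert by (intro reach.col[OF reach_mono[OF B(1)] _ _ _ invertible_2x2_add_upper]) auto
  moreover have "\<forall>i m. m \<notin> insert j S \<longrightarrow> ?C i m = A i m"
    using insert B(2) by (auto simp: col_op_def)
  moreover have "\<forall>m\<in>insert j S. ?C k m = 0"
    using insert B(2,3) v by (auto simp: col_op_def)
  ultimately show ?case by blast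
qed

lemma clear_col:
  assumes "finite S" "k \<notin> S" "\<And>i. i \<in> S \<Longrightarrow> (A :: nat \<Rightarrow> nat \<Rightarrow> 'a) k l ldvd A i l"
  shows "\<exists>B. reach (insert k S) {} A B \<and> (\<forall>i j. i \<notin> S \<longrightarrow> B i j = A i j) \<and> (\<forall>i\<in>S. B i l = 0)"
  using assms
proof (induction S)
  case empty
  show ?case using reach.refl by blast
next
  case (insert i S)
  then obtain B where B: "reach (insert k S) {} A B" "\<And>i j. i \<notin> S \<Longrightarrow> B i j = A i j"
    "\<forall>i\<in>S. B i l = 0" by auto
  \<comment> \<open>Row operations multiply from the left, so the pivot has to be a right
    factor.\<close>
  obtain v where v: "A i l = v * A k l" using insert.prems(2) ldvd_left by blast
  let ?C = "row_op k i 1 0 (- v) 1 B"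
  have "reach (insert k (insert i S)) {} A ?C"
    using insert by (intro reach.row[OF reach_mono[OF B(1)] _ _ _ invertible_2x2_add_lower]) auto
  moreover have "\<forall>m j. m \<notin> insert i S \<longrightarrow> ?C m j = A m j"
    using insert B(2) by (auto simp: row_op_def)
  moreover have "\<forall>m\<in>insert i S. ?C m l = 0"
    using insert B(2,3) v by (auto simp: row_op_def)
  ultimately show ?case by blast
qed

text \<open>Clearing row \<open>k\<close> does not alter column \<open>l\<close>, and clearing
  column \<open>l\<close> does not alter row \<open>k\<close>. The pivot keeps its value and so
  still divides everything.\<close>

lemma clear_cross:
  assumes fin: "finite I" "finite J" and kl: "k \<in> I" "l \<in> J"
    and dv: "\<And>i j. i \<in> I \<Longrightarrow> j \<in> J \<Longrightarrow> (A :: nat \<Rightarrow> nat \<Rightarrow> 'a) k l ldvd A i j"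
  shows "\<exists>B. reach I J A B \<and> (\<forall>i\<in>I. \<forall>j\<in>J. B k l ldvd B i j) \<and>
    (\<forall>j\<in>J - {l}. B k j = 0) \<and> (\<forall>i\<in>I - {k}. B i l = 0)"
proof -
  obtain B where B: "reach {} (insert l (J - {l})) A B" "\<And>i j. j \<notin> J - {l} \<Longrightarrow> B i j = A i j"
    "\<forall>j\<in>J - {l}. B k j = 0" using clear_row[of "J - {l}" l A k] fin kl dv by auto
  have "B k l ldvd B i l" if "i \<in> I - {k}" for i using that B(2)[of l] kl dv by auto
  then obtain C where C: "reach (insert k (I - {k})) {} B C" "\<And>i j. i \<notin> I - {k} \<Longrightarrow> C i j = B i j"
    "\<forall>i\<in>I - {k}. C i l = 0" using clear_col[of "I - {k}" k B l] fin by auto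
  have r: "reach I J A C"
    using kl by (intro reach_trans[OF reach_mono[OF B(1)] reach_mono[OF C(1)]]) auto
  have "C k l = A k l" using C(2)[of k l] B(2)[of l k] by simp
  then have "\<forall>i\<in>I. \<forall>j\<in>J. C k l ldvd C i j" using reach_ldvd[OF r dv] by simp
  moreover have "\<forall>j\<in>J - {l}. C k j = 0" using B(3) C(2) by auto
  ultimately show ?thesis using r C(3) by blast
qed

end

section \<open>Pivots and diagonalization over a Zabavsky duo domain\<close>

locale duo_zabavsky_domain = duo_bezout_domain T for T :: "'a::ring_1_no_zero_divisors itself" +
  assumes zabavsky: "rmul a + rmul (b::'a) = UNIV \<Longrightarrow> \<exists>y. feckly_adequate (a + b * y)"
begin

text \<open>The corner receives an element dividing the greatest common divisor
  \<open>\<delta>\<close> of the entries. Reversibility keeps \<open>\<delta>\<close> the greatest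
  common divisor at every stage, so unimodularity can be tested after dividing by it.\<close>

lemma pivot_two_by_two:
  fixes A :: "nat \<Rightarrow> nat \<Rightarrow> 'a"
  assumes ik: "i \<noteq> k" and lm: "l \<noteq> m" and Akm: "A k m = 0"
  shows "\<exists>B. reach {i,k} {l,m} A B \<and> (\<forall>p\<in>{i,k}. \<forall>q\<in>{l,m}. B i l ldvd B p q)"
proof -
  note neq = ik lm ik[symmetric] lm[symmetric]
  define a b c where "a = A i m" and "b = A i l" and "c = A k l"
  obtain g1 x1 y1 where g1: "b * x1 + a * y1 = g1" "g1 ldvd b" "g1 ldvd a" using gcd_right by blast
  obtain \<delta> x2 z where \<delta>: "g1 * x2 + c * z = \<delta>" "\<delta> ldvd g1" "\<delta> ldvd c" using gcd_right by blast
  have \<delta>abc: "\<delta> ldvd a" "\<delta> ldvd b" "\<delta> ldvd c"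
    using ldvd_trans[OF \<delta>(2) g1(3)] ldvd_trans[OF \<delta>(2) g1(2)] \<delta>(3) by auto
  then have \<delta>A: "\<delta> ldvd A p q" if "p \<in> {i,k}" "q \<in> {l,m}" for p q
    using that Akm ldvd_0[of \<delta>] unfolding a_def b_def c_def by auto
  have A_\<delta>: "h ldvd \<delta>" if "\<And>p q. p \<in> {i,k} \<Longrightarrow> q \<in> {l,m} \<Longrightarrow> h ldvd A p q" for h
    unfolding \<delta>(1)[symmetric] g1(1)[symmetric] using that by (auto simp: a_def b_def c_def intro!: ldvd)
  show ?thesis
  proof (cases "\<delta> = 0")
    \<comment> \<open>\<open>\<delta>\<close> cannot be cancelled here, but then the whole block
      vanishes.\<close>
    case True
    then have "A p q = 0" if "p \<in> {i,k}" "q \<in> {l,m}" for p q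
      using \<delta>A[OF that] unfolding ldvd_def by simp
    then have "\<forall>p\<in>{i,k}. \<forall>q\<in>{l,m}. A i l ldvd A p q" by (simp add: ldvd_0)
    then show ?thesis using reach.refl by blast
  next
    case False
    \<comment> \<open>With these coefficients
      \<open>\<delta> = b * x + a * y + c * z\<close>.\<close>
    define x y where "x = x1 * x2" and "y = y1 * x2"
    obtain a' b' c' where abc: "a = \<delta> * a'" "b = \<delta> * b'" "c = \<delta> * c'"
      using \<delta>abc unfolding ldvd_def by blast
    have "\<delta> * (b' * x + (a' * y + c' * z) * 1) = b * x + a * y + c * z"
      unfolding abc by (simp add: algebra_simps)
    also have "\<dots> = \<delta> * 1" unfolding x_def y_def \<delta>(1)[symmetric] g1(1)[symmetric] by (simp add: algebra_simps)
    finally have "b' * x + (a' * y + c' * z) * 1 = 1" using False by (simp only: mult_cancel_left) simp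
    then have "rmul b' + rmul (a' * y + c' * z) = UNIV" unfolding rmul_sum_UNIV_iff by blast
    then obtain t where t: "feckly_adequate (b' + (a' * y + c' * z) * t)" using zabavsky by blast
    define \<beta> where "\<beta> = b' + (a' * y + c' * z) * t"
    \<comment> \<open>The multiple of \<open>a\<close> is added by a column operation. That of
      \<open>c\<close> comes from a row operation, so its coefficient must stand on the
      left.\<close>
    obtain \<kappa> where \<kappa>: "c * (z * t) = \<kappa> * c" using commute_left by blast
    have "\<delta> * \<beta> = b + a * (y * t) + c * (z * t)"
      unfolding \<beta>_def abc by (simp add: algebra_simps)
    then have \<beta>: "\<delta> * \<beta> = b + a * (y * t) + \<kappa> * c" unfolding \<kappa> .
    define A1 where "A1 = col_op l m 1 0 (y * t) 1 A"
    define A2 where "A2 = row_op i k 1 \<kappa> 0 1 A1"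
    have A2: "A2 i l = \<delta> * \<beta>" "A2 i m = a" "A2 k l = c" "A2 k m = 0"
      unfolding A2_def A1_def \<beta> using neq Akm by (auto simp: row_op_def col_op_def a_def b_def c_def)
    obtain x3 y3 u3 w3 g where H3: "invertible_2x2 x3 y3 u3 w3" "x3 * (\<delta> * \<beta>) + y3 * c = g"
      "u3 * (\<delta> * \<beta>) + w3 * c = 0" "g ldvd \<delta> * \<beta>" using hermite_left[of "\<delta> * \<beta>" c] by blast
    define A3 where "A3 = row_op i k x3 y3 u3 w3 A2"
    define e f where "e = x3 * a" and "f = u3 * a"
    have A3: "A3 i l = g" "A3 i m = e" "A3 k l = 0" "A3 k m = f"
      unfolding A3_def using neq A2 H3 by (auto simp: row_op_def e_def f_def)
    have "reach {i,k} {l,m} A A1" unfolding A1_def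
      using neq by (intro reach_col_op invertible_2x2_add_lower) auto
    then have "reach {i,k} {l,m} A A2" unfolding A2_def
      using neq by (intro reach.row invertible_2x2_add_upper) auto
    then have r3: "reach {i,k} {l,m} A A3" unfolding A3_def
      using neq H3 by (intro reach.row) auto
    have "\<delta> ldvd g" "\<delta> ldvd e" "\<delta> ldvd f"
      using reach_ldvd[OF r3 \<delta>A] A3 by (metis insertCI)+
    then obtain d e' f' where def: "g = \<delta> * d" "e = \<delta> * e'" "f = \<delta> * f'" unfolding ldvd_def by blast
    have "d ldvd \<beta>"
      using H3(4) False unfolding def ldvd_def by (metis mult.assoc mult_left_cancel)
    \<comment> \<open>The common divisor \<open>h\<close> of \<open>g\<close>, \<open>e\<close> and
      \<open>f\<close> divides the original entries by reversibility, hence \<open>\<delta>\<close>.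
      Cancelling \<open>\<delta>\<close> then makes \<open>d\<close>, \<open>e'\<close> and
      \<open>f'\<close> unimodular.\<close>
    obtain h1 x4 y4 where h1: "g * x4 + e * y4 = h1" "h1 ldvd g" "h1 ldvd e" using gcd_right by blast
    obtain h x5 z5 where h: "h1 * x5 + f * z5 = h" "h ldvd h1" "h ldvd f" using gcd_right by blast
    have "h ldvd A3 p q" if "p \<in> {i,k}" "q \<in> {l,m}" for p q
      using that A3 h(3) ldvd_trans[OF h(2) h1(2)] ldvd_trans[OF h(2) h1(3)] ldvd_0[of h] by auto
    then have "h ldvd \<delta>" by (intro A_\<delta> reach_ldvd[OF reach_sym[OF r3]]) auto
    then obtain h' where h': "\<delta> = h * h'" unfolding ldvd_def by blast
    have "\<delta> * (d * (x4 * x5 * h') + e' * (y4 * x5 * h') + f' * (z5 * h')) = h * h'"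
      unfolding h(1)[symmetric] h1(1)[symmetric] def by (simp add: algebra_simps)
    also have "\<dots> = \<delta> * 1" using h' by simp
    finally have "d * (x4 * x5 * h') + e' * (y4 * x5 * h') + f' * (z5 * h') = 1"
      using False by (simp only: mult_cancel_left) simp
    then obtain r x6 y6 where r: "d * x6 + (e' + r * f') * y6 = 1"
      using feckly_adequate_stable[OF t[folded \<beta>_def] \<open>d ldvd \<beta>\<close>] by blast
    \<comment> \<open>The row operation with \<open>r'\<close> on the undivided matrix amounts to
      the one with \<open>r\<close> after division by \<open>\<delta>\<close>.\<close>
    obtain r' where r': "\<delta> * r = r' * \<delta>" using commute_left by blast
    have ef: "e + r' * f = \<delta> * (e' + r * f')"
      unfolding def distrib_left mult.assoc[symmetric] r' ..
    obtain x7 y7 u7 w7 p where H7: "invertible_2x2 x7 y7 u7 w7" "g * x7 + (e + r' * f) * u7 = p"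
      "p ldvd g" "p ldvd e + r' * f" using hermite_right[of g "e + r' * f"] by blast
    define A4 where "A4 = row_op i k 1 r' 0 1 A3"
    define A5 where "A5 = col_op l m x7 y7 u7 w7 A4"
    have A4: "A4 i l = g" "A4 i m = e + r' * f"
      unfolding A4_def using neq A3 by (auto simp: row_op_def)
    have A5: "A5 i l = p" unfolding A5_def using A4 H7 by (simp add: col_op_def)
    have "reach {i,k} {l,m} A A4" unfolding A4_def
      using neq r3 by (intro reach.row invertible_2x2_add_upper) auto
    then have r5: "reach {i,k} {l,m} A A5" unfolding A5_def
      using neq H7 by (intro reach.col) auto
    have "\<delta> = \<delta> * (d * x6 + (e' + r * f') * y6)" unfolding r by simp
    also have "\<dots> = g * x6 + (e + r' * f) * y6"
      unfolding ef def(1) by (simp add: algebra_simps)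
    finally have "p ldvd \<delta>" using ldvd_add[OF ldvd_mult2[OF H7(3)] ldvd_mult2[OF H7(4)]] by metis
    have "p ldvd A5 i' j'" if "i' \<in> {i,k}" "j' \<in> {l,m}" for i' j'
      by (rule reach_ldvd[OF r5 ldvd_trans[OF \<open>p ldvd \<delta>\<close> \<delta>A] that])
    then show ?thesis using r5 A5 by blast
  qed
qed

text \<open>Rows are added one at a time. The cross of the old pivot is cleared and the new row is
  compressed to two entries, which leaves a \<open>2 x 2\<close> block with a zero for
  \<open>pivot_two_by_two\<close>.\<close>

lemma pivot_exists:
  fixes A :: "nat \<Rightarrow> nat \<Rightarrow> 'a"
  assumes "finite I" "I \<noteq> {}" and J: "finite J" "J \<noteq> {}"
  shows "\<exists>B. reach I J A B \<and> (\<exists>k\<in>I. \<exists>l\<in>J. \<forall>i\<in>I. \<forall>j\<in>J. B k l ldvd B i j)"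
  using assms(1,2)
proof (induction rule: finite_ne_induct)
  case (singleton k)
  obtain l where l: "l \<in> J" using J by blast
  then obtain B where B: "reach {} (insert l (J - {l})) A B" "\<forall>j\<in>J - {l}. B k j = 0"
    using row_reduce[of "J - {l}" l A k] J by auto
  have "reach {k} J A B" using l by (intro reach_mono[OF B(1)]) auto
  moreover have "\<forall>j\<in>J. B k l ldvd B k j" using B(2) ldvd_0 ldvd_refl by (metis DiffI singletonD)
  ultimately show ?case using l by auto
next
  case (insert i F)
  then obtain B k l where B: "reach F J A B" and kl: "k \<in> F" "l \<in> J"
    and dv: "\<And>i j. i \<in> F \<Longrightarrow> j \<in> J \<Longrightarrow> B k l ldvd B i j" by blast
  obtain C where C: "reach F J B C" "\<And>i j. i \<in> F \<Longrightarrow> j \<in> J \<Longrightarrow> C k l ldvd C i j"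
    "\<forall>j\<in>J - {l}. C k j = 0"
    using clear_cross[where A = B, OF insert(1) J(1) kl dv] by blast
  have ik: "i \<noteq> k" using kl insert by blast
  have AC: "reach (insert i F) J A C"
    by (rule reach_mono[OF reach_trans[OF B C(1)]]) auto
  show ?case
  proof (cases "J = {l}")
    \<comment> \<open>With no second column, a Hermite step on the rows \<open>i\<close> and
      \<open>k\<close> is enough.\<close>
    case True
    obtain x y u w d where H: "invertible_2x2 x y u w" "x * C i l + y * C k l = d" "d ldvd C i l" "d ldvd C k l"
      using hermite_left by blast
    let ?D = "row_op i k x y u w C"
    have CD: "reach (insert i F) J C ?D" using ik kl H by (intro reach_row_op) auto
    have "d ldvd C p j" if "p \<in> insert i F" "j \<in> J" for p j
      using that True H(3) ldvd_trans[OF H(4) C(2)] by auto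
    then have "d ldvd ?D p j" if "p \<in> insert i F" "j \<in> J" for p j
      using that by (intro reach_ldvd[OF CD])
    moreover have "?D i l = d" using H by (simp add: row_op_def)
    ultimately show ?thesis using reach_trans[OF AC CD] kl by blast
  next
    case False
    then obtain m where m: "m \<in> J" "m \<noteq> l" using kl by blast
    \<comment> \<open>Collecting row \<open>i\<close> in column \<open>m\<close> uses only columns
      other than \<open>l\<close>: row \<open>k\<close> stays zero there, and the old pivot is
      unchanged.\<close>
    obtain E where E: "reach {} (insert m (J - {l,m})) C E" "\<forall>j\<in>J - {l,m}. E i j = 0"
      using row_reduce[of "J - {l,m}" m C i] J by auto
    have ins: "insert m (J - {l,m}) = J - {l}" using m by blast
    note E1 = E(1)[unfolded ins]
    have CE: "reach F J C E" by (rule reach_mono[OF E1]) auto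
    have "E k j = 0" if "j \<in> J - {l}" for j
      using reach_zero_row[OF E1, of k j] that C(3) by auto
    then have Ekm: "E k m = 0" using m by simp
    have Ekl: "E k l = C k l" by (rule reach_outside[OF E1]) auto
    have dvE: "E k l ldvd E p j" if "p \<in> F" "j \<in> J" for p j
      unfolding Ekl by (rule reach_ldvd[OF CE C(2) that])
    obtain G where G: "reach {i,k} {l,m} E G" "\<And>p q. p \<in> {i,k} \<Longrightarrow> q \<in> {l,m} \<Longrightarrow> G i l ldvd G p q"
      using pivot_two_by_two[where A = E, OF ik m(2)[symmetric] Ekm] by blast
    have four: "G i l ldvd E p q" if "p \<in> {i,k}" "q \<in> {l,m}" for p q
      by (rule reach_ldvd[OF reach_sym[OF G(1)] G(2) that])
    \<comment> \<open>The rest of row \<open>i\<close> is zero, and the old rows are divisible by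
      \<open>E k l\<close>, which the new pivot divides.\<close>
    have all: "G i l ldvd E p j" if "p \<in> insert i F" "j \<in> J" for p j
    proof (cases "p = i")
      case True
      then show ?thesis using four[of i j] E(2) that ldvd_0 by (cases "j \<in> {l,m}") auto
    next
      case False
      then show ?thesis using ldvd_trans[OF four[of k l] dvE] that by auto
    qed
    have EG: "reach (insert i F) J E G" using kl m by (intro reach_mono[OF G(1)]) auto
    have "reach (insert i F) J A G"
      by (rule reach_trans[OF reach_trans[OF AC reach_mono[OF CE]] EG]) auto
    moreover have "G i l ldvd G p j" if "p \<in> insert i F" "j \<in> J" for p j
      by (rule reach_ldvd[OF EG all that])
    ultimately show ?thesis using kl by blast
  qed
qed

text \<open>Swaps carry the pivot from wherever \<open>pivot_exists\<close> put it to the prescribed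
  place.\<close>

lemma pivot_clear:
  fixes A :: "nat \<Rightarrow> nat \<Rightarrow> 'a"
  assumes fin: "finite I" "finite J" and kl: "k \<in> I" "l \<in> J"
  shows "\<exists>B. reach I J A B \<and> (\<forall>i\<in>I. \<forall>j\<in>J. B k l ldvd B i j) \<and>
    (\<forall>j\<in>J - {l}. B k j = 0) \<and> (\<forall>i\<in>I - {k}. B i l = 0)"
proof -
  obtain B k' l' where B: "reach I J A B" and kl': "k' \<in> I" "l' \<in> J"
    and dv: "\<And>i j. i \<in> I \<Longrightarrow> j \<in> J \<Longrightarrow> B k' l' ldvd B i j"
    using pivot_exists[OF fin(1) _ fin(2), of A] kl by blast
  have "\<exists>C. reach I J B C \<and> C k l' = B k' l'"
  proof (cases "k = k'")
    case True then show ?thesis using reach.refl by blast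
  next
    case False
    then show ?thesis using reach_row_op[OF kl(1) kl'(1) False invertible_2x2_swap, of J B]
      by (intro exI[of _ "row_op k k' 0 1 1 0 B"]) (simp add: row_op_def)
  qed
  then obtain C where C: "reach I J B C" "C k l' = B k' l'" by blast
  have "\<exists>D. reach I J C D \<and> D k l = C k l'"
  proof (cases "l = l'")
    case True then show ?thesis using reach.refl by blast
  next
    case False
    then show ?thesis using reach_col_op[OF kl(2) kl'(2) False invertible_2x2_swap, of I C]
      by (intro exI[of _ "col_op l l' 0 1 1 0 C"]) (simp add: col_op_def)
  qed
  then obtain D where D: "reach I J C D" "D k l = C k l'" by blast
  have BD: "reach I J B D" using C(1) D(1) by (rule reach_trans)
  have "D k l ldvd D i j" if "i \<in> I" "j \<in> J" for i j
    unfolding D(2) C(2) by (rule reach_ldvd[OF BD dv that])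
  from clear_cross[where A = D, OF fin kl this] obtain E where "reach I J D E"
    "(\<forall>i\<in>I. \<forall>j\<in>J. E k l ldvd E i j) \<and> (\<forall>j\<in>J - {l}. E k j = 0) \<and> (\<forall>i\<in>I - {k}. E i l = 0)"
    by blast
  then show ?thesis using reach_trans[OF reach_trans[OF B BD]] by blast
qed

text \<open>Operations confined to indices from \<open>t\<close> on preserve the diagonal shape
  already reached, so only the divisibilities from \<open>t\<close> on are asserted.\<close>

lemma diagonalize_from:
  fixes A :: "nat \<Rightarrow> nat \<Rightarrow> 'a"
  assumes "\<And>i j. i < m \<Longrightarrow> j < n \<Longrightarrow> i \<noteq> j \<Longrightarrow> i < t \<or> j < t \<Longrightarrow> A i j = 0"
  shows "\<exists>B. reach {t..<m} {t..<n} A B \<and> (\<forall>i<m. \<forall>j<n. i \<noteq> j \<longrightarrow> B i j = 0) \<and>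
    (\<forall>i\<ge>t. Suc i < min m n \<longrightarrow> B i i ldvd B (Suc i) (Suc i))"
  using assms
proof (induction "min m n - t" arbitrary: t A)
  case 0
  \<comment> \<open>Now all rows or all columns lie before \<open>t\<close>.\<close>
  then have "A i j = 0" if "i < m" "j < n" "i \<noteq> j" for i j
    using that by (intro 0) auto
  moreover have "\<not> Suc i < min m n" if "i \<ge> t" for i using 0(1) that by auto
  ultimately show ?case using reach.refl by blast
next
  case (Suc s)
  then have t: "t < m" "t < n" by auto
  obtain B where B: "reach {t..<m} {t..<n} A B" "\<And>i j. i \<in> {t..<m} \<Longrightarrow> j \<in> {t..<n} \<Longrightarrow> B t t ldvd B i j"
    "\<forall>j\<in>{t..<n} - {t}. B t j = 0" "\<forall>i\<in>{t..<m} - {t}. B i t = 0"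
    using pivot_clear[of "{t..<m}" "{t..<n}" t t A] t by auto
  have zero: "B i j = 0" if "i < m" "j < n" "i \<noteq> j" "i < Suc t \<or> j < Suc t" for i j
  proof (cases "i < t \<or> j < t")
    case True
    show ?thesis
    proof (cases "i < t")
      case i: True
      show ?thesis
      proof (cases "j < t")
        case True
        then show ?thesis using reach_outside[OF B(1), of i j] i Suc.prems that by auto
      next
        case False
        then show ?thesis using i that by (intro reach_zero_row[OF B(1)] Suc.prems) auto
      qed
    next
      case False
      then show ?thesis using True that by (intro reach_zero_col[OF B(1)] Suc.prems) auto
    qed
  next
    case False
    then have "(i = t \<and> j \<in> {t..<n} - {t}) \<or> (j = t \<and> i \<in> {t..<m} - {t})" using that by auto
    then show ?thesis using B(3,4) by auto
  qed
  have "s = min m n - Suc t" using Suc.hyps(2) by simp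
  from Suc.hyps(1)[where A = B, OF this zero] obtain C where C: "reach {Suc t..<m} {Suc t..<n} B C"
    "\<forall>i<m. \<forall>j<n. i \<noteq> j \<longrightarrow> C i j = 0"
    "\<forall>i\<ge>Suc t. Suc i < min m n \<longrightarrow> C i i ldvd C (Suc i) (Suc i)" by blast
  have BC: "reach {t..<m} {t..<n} B C" by (rule reach_mono[OF C(1)]) auto
  have "C t t = B t t" by (rule reach_outside[OF C(1)]) auto
  \<comment> \<open>The pivot \<open>B t t\<close> divides its whole block, hence whatever later
    operations create inside it.\<close>
  then have "C t t ldvd C (Suc t) (Suc t)" if "Suc t < min m n"
    using reach_ldvd[OF BC B(2)] that by simp
  then have "\<forall>i\<ge>t. Suc i < min m n \<longrightarrow> C i i ldvd C (Suc i) (Suc i)"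
    using C(3) by (metis le_antisym not_less_eq_eq)
  then show ?case using C(2) reach_trans[OF B(1) BC] by blast
qed

lemma bimul_subset:
  assumes "(d::'a) ldvd e"
  shows "bimul e \<subseteq> rmul d \<inter> lmul d"
proof -
  have "e \<in> rmul d" "e \<in> lmul d"
    using assms ldvd_left unfolding ldvd_def rmul_def lmul_def by blast+
  moreover have "two_sided_ideal (rmul d)" "two_sided_ideal (lmul d)"
    using duo right_ideal_rmul left_ideal_lmul unfolding duo_ring_def by blast+
  ultimately show ?thesis unfolding bimul_def by (auto dest: hull_minimal[THEN subsetD, rotated 2])
qed

end

subsection \<open>Reduction of matrices\<close>

text \<open>The identity matrix as an array; \<open>row_op\<close> and \<open>col_op\<close> turn it
  into elementary matrices.\<close>

definition delta :: "nat \<Rightarrow> nat \<Rightarrow> 'a::ring_1" where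
  "delta i j = (if i = j then 1 else 0)"

lemma mat_delta: "mat n n (\<lambda>(i,j). delta i j) = 1\<^sub>m n"
  by (auto simp: delta_def)

lemma row_op_mat:
  assumes "k < m" "l < m" "k \<noteq> l"
  shows "mat m m (\<lambda>(i,j). row_op k l x y u w delta i j) * mat m n (\<lambda>(i,j). A i j) =
    mat m n (\<lambda>(i,j). row_op k l x y u w A i j)"
  using assms
  by (intro eq_matI)
    (auto simp: scalar_prod_def row_op_def delta_def distrib_right sum.distrib mult.assoc sum_distrib_left[symmetric]
      if_distrib[of "\<lambda>a. a * _"] if_distrib[of "\<lambda>a. _ * a"] sum.delta sum.delta' cong: if_cong)

lemma col_op_mat:
  assumes "k < n" "l < n" "k \<noteq> l"
  shows "mat m n (\<lambda>(i,j). A i j) * mat n n (\<lambda>(i,j). col_op k l x y u w delta i j) =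
    mat m n (\<lambda>(i,j). col_op k l x y u w A i j)"
  using assms
  by (intro eq_matI)
    (auto simp: scalar_prod_def col_op_def delta_def distrib_left sum.distrib mult.assoc[symmetric] sum_distrib_right[symmetric]
      if_distrib[of "\<lambda>a. a * _"] if_distrib[of "\<lambda>a. _ * a"] sum.delta sum.delta' cong: if_cong)

lemma invertible_row_op:
  assumes "k < m" "l < m" "k \<noteq> l" "invertible_2x2 x y u w"
  shows "invertible_mat (mat m m (\<lambda>(i,j). row_op k l x y u w delta i j))" (is "invertible_mat ?P")
proof -
  obtain x' y' u' w' where inv: "row_op k l x' y' u' w' (row_op k l x y u w A) = A"
    "row_op k l x y u w (row_op k l x' y' u' w' A) = A" for A :: "nat \<Rightarrow> nat \<Rightarrow> 'a"
    using invertible_2x2_row_op[OF assms(4,3)] by metis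
  let ?Q = "mat m m (\<lambda>(i,j). row_op k l x' y' u' w' delta i j)"
  have "?P * ?Q = 1\<^sub>m m" "?Q * ?P = 1\<^sub>m m"
    using row_op_mat[OF assms(1-3)] inv mat_delta by metis+
  then show ?thesis unfolding invertible_mat_def inverts_mat_def by (auto intro!: exI[of _ ?Q])
qed

lemma invertible_col_op:
  assumes "k < m" "l < m" "k \<noteq> l" "invertible_2x2 x y u w"
  shows "invertible_mat (mat m m (\<lambda>(i,j). col_op k l x y u w delta i j))" (is "invertible_mat ?P")
proof -
  obtain x' y' u' w' where inv: "col_op k l x' y' u' w' (col_op k l x y u w A) = A"
    "col_op k l x y u w (col_op k l x' y' u' w' A) = A" for A :: "nat \<Rightarrow> nat \<Rightarrow> 'a"
    using invertible_2x2_col_op[OF assms(4,3)] by metis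
  let ?Q = "mat m m (\<lambda>(i,j). col_op k l x' y' u' w' delta i j)"
  have "?P * ?Q = 1\<^sub>m m" "?Q * ?P = 1\<^sub>m m"
    using col_op_mat[OF assms(1-3)] inv mat_delta by metis+
  then show ?thesis unfolding invertible_mat_def inverts_mat_def by (auto intro!: exI[of _ ?Q])
qed

lemma invertible_mat_times:
  assumes "P \<in> carrier_mat n n" "Q \<in> carrier_mat n n" "invertible_mat P" "invertible_mat Q"
  shows "invertible_mat (P * Q :: 'a::ring_1 mat)"
proof -
  have inv: "\<exists>X'\<in>carrier_mat n n. X * X' = 1\<^sub>m n \<and> X' * X = 1\<^sub>m n"
    if X: "X \<in> carrier_mat n n" "invertible_mat X" for X :: "'a mat"
  proof -
    obtain X' where "inverts_mat X X'" "inverts_mat X' X"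
      using X(2) unfolding invertible_mat_def by blast
    then have X': "X * X' = 1\<^sub>m n" "X' * X = 1\<^sub>m (dim_row X')"
      using X(1) unfolding inverts_mat_def by auto
    \<comment> \<open>\<open>inverts_mat\<close> does not fix the size of the inverse; counting the
      columns of both products recovers it.\<close>
    have "dim_col X' = n" using arg_cong[OF X'(1), of dim_col] by simp
    moreover have "dim_row X' = n" using arg_cong[OF X'(2), of dim_col] X(1) by simp
    ultimately show ?thesis using X' by (intro bexI[of _ X']) auto
  qed
  from inv assms obtain P' Q' where c: "P' \<in> carrier_mat n n" "Q' \<in> carrier_mat n n" and
    i: "P * P' = 1\<^sub>m n" "P' * P = 1\<^sub>m n" "Q * Q' = 1\<^sub>m n" "Q' * Q = 1\<^sub>m n" by metis
  have "P * Q * (Q' * P') = P * (Q * Q') * P'" "Q' * P' * (P * Q) = Q' * (P' * P) * Q"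
    using assms(1,2) c by (simp_all add: assoc_mult_mat[of _ n n _ n _ n])
  then have "P * Q * (Q' * P') = 1\<^sub>m n" "Q' * P' * (P * Q) = 1\<^sub>m n"
    unfolding i using assms(1,2) c i by simp_all
  then show ?thesis unfolding invertible_mat_def inverts_mat_def
    using assms(1,2) c by (auto intro!: exI[of _ "Q' * P'"])
qed

lemma reach_mat:
  assumes "reach {..<m} {..<n} A B"
  shows "\<exists>P Q. P \<in> carrier_mat m m \<and> invertible_mat P \<and> Q \<in> carrier_mat n n \<and> invertible_mat Q \<and>
    mat m n (\<lambda>(i,j). B i j) = P * mat m n (\<lambda>(i,j). A i j) * Q"
  using assms
proof (induction)
  case (refl A)
  have "invertible_mat (1\<^sub>m k :: 'a mat)" for k
    unfolding invertible_mat_def inverts_mat_def by (auto intro!: exI[of _ "1\<^sub>m k"])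
  then show ?case by (intro exI[of _ "1\<^sub>m m"] exI[of _ "1\<^sub>m n"]) auto
next
  case (row A B k l x y u w)
  then obtain P Q where PQ: "P \<in> carrier_mat m m" "invertible_mat P" "Q \<in> carrier_mat n n" "invertible_mat Q"
    "mat m n (\<lambda>(i,j). B i j) = P * mat m n (\<lambda>(i,j). A i j) * Q" by blast
  let ?E = "mat m m (\<lambda>(i,j). row_op k l x y u w delta i j)"
  have "mat m n (\<lambda>(i,j). row_op k l x y u w B i j) = ?E * (P * mat m n (\<lambda>(i,j). A i j) * Q)"
    unfolding PQ(5)[symmetric] using row by (intro row_op_mat[symmetric]) auto
  also have "\<dots> = ?E * P * mat m n (\<lambda>(i,j). A i j) * Q"
    using PQ by (simp add: assoc_mult_mat[of _ m m _ m _ n] assoc_mult_mat[of _ m m _ n _ n])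
  finally have "mat m n (\<lambda>(i,j). row_op k l x y u w B i j) = ?E * P * mat m n (\<lambda>(i,j). A i j) * Q" .
  moreover have "invertible_mat (?E * P)"
    using PQ row by (intro invertible_mat_times[of _ m] invertible_row_op) auto
  moreover have "?E * P \<in> carrier_mat m m" using PQ by (intro mult_carrier_mat[of _ m m]) auto
  ultimately show ?case using PQ by blast
next
  case (col A B k l x y u w)
  then obtain P Q where PQ: "P \<in> carrier_mat m m" "invertible_mat P" "Q \<in> carrier_mat n n" "invertible_mat Q"
    "mat m n (\<lambda>(i,j). B i j) = P * mat m n (\<lambda>(i,j). A i j) * Q" by blast
  let ?E = "mat n n (\<lambda>(i,j). col_op k l x y u w delta i j)"
  have "mat m n (\<lambda>(i,j). col_op k l x y u w B i j) = P * mat m n (\<lambda>(i,j). A i j) * Q * ?E"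
    unfolding PQ(5)[symmetric] using col by (intro col_op_mat[symmetric]) auto
  also have "\<dots> = P * mat m n (\<lambda>(i,j). A i j) * (Q * ?E)"
    using PQ by (intro assoc_mult_mat[of _ m n _ n _ n]) auto
  finally have "mat m n (\<lambda>(i,j). col_op k l x y u w B i j) = P * mat m n (\<lambda>(i,j). A i j) * (Q * ?E)" .
  moreover have "invertible_mat (Q * ?E)"
    using PQ col by (intro invertible_mat_times[of _ n] invertible_col_op) auto
  moreover have "Q * ?E \<in> carrier_mat n n" using PQ by (intro mult_carrier_mat[of _ n n]) auto
  ultimately show ?case using PQ by blast
qed

theorem theorem3p9:
  assumes "zabavsky_domain TYPE('a::ring_1_no_zero_divisors)"
    and "duo_ring TYPE('a)"
  shows "elementary_divisor_ring TYPE('a)"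
proof -
  interpret duo_zabavsky_domain "TYPE('a)"
    using assms unfolding zabavsky_domain_def by unfold_locales auto
  have "admits_diagonal_reduction A" for A :: "'a mat"
  proof -
    let ?m = "dim_row A" and ?n = "dim_col A"
    obtain B where B: "reach {..<?m} {..<?n} (\<lambda>i j. A $$ (i,j)) B"
      "\<forall>i<?m. \<forall>j<?n. i \<noteq> j \<longrightarrow> B i j = 0"
      "\<forall>i. Suc i < min ?m ?n \<longrightarrow> B i i ldvd B (Suc i) (Suc i)"
      \<comment> \<open>For \<open>t = 0\<close> no index lies before \<open>t\<close>, so the
        premise is vacuous.\<close>
      using diagonalize_from[of ?m ?n 0 "\<lambda>i j. A $$ (i,j)"] by (auto simp: atLeast0LessThan)
    let ?D = "mat ?m ?n (\<lambda>(i,j). B i j)"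
    have A: "mat ?m ?n (\<lambda>(i,j). A $$ (i,j)) = A" by (intro eq_matI) auto
    obtain P Q where "P \<in> carrier_mat ?m ?m" "invertible_mat P" "Q \<in> carrier_mat ?n ?n"
      "invertible_mat Q" "?D = P * A * Q" using reach_mat[OF B(1)] unfolding A by blast
    moreover have "diagonal_mat ?D" using B(2) unfolding diagonal_mat_def by auto
    moreover have "\<forall>i. Suc i < min ?m ?n \<longrightarrow>
        bimul (?D $$ (Suc i, Suc i)) \<subseteq> rmul (?D $$ (i, i)) \<inter> lmul (?D $$ (i, i))"
      using B(3) bimul_subset by simp
    ultimately show ?thesis unfolding admits_diagonal_reduction_def by blast
  qed
  then show ?thesis unfolding elementary_divisor_ring_def by blast
qed

end
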